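(* For every even integer $h\ge2$, every $\alpha\in(\mathbb Z/2h\mathbb Z)^\times$, and every integer $n\ge0$, $$L(-2n-1,b_\alpha)\neq0 .$$
   Context: Write $e(x)=e^{2\pi i x}$ and $T_k=k(k+1)/2$. For $h\ge2$ even, $\alpha\in(\mathbb Z/2h\mathbb Z)^\times$ and an odd integer $u$ representing $\alpha$, $b_\alpha:\mathbb Z\to\mathbb C$ is the $4h$-periodic function $b_\alpha(2k+1):=e(uT_k/h)$, $b_\alpha(2k):=0$ ($k\in\mathbb Z$); it does not depend on the representative $u$. For $\Re(s)>1$ set $L(s,b_\alpha)=\sum_{m\ge1}b_\alpha(m)m^{-s}$; this is continued to $\mathbb C$ via $L(s,b_\alpha)=(4h)^{-s}\sum_{r=1}^{4h}b_\alpha(r)\zeta(s,r/(4h))$ (Hurwitz zeta function). (The function $b_\alpha$ has mean zero over a period, so the continuation is entire.) *)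

theory Defs
  imports "HOL-Complex_Analysis.Complex_Analysis" "HOL-Number_Theory.Residues"
begin

definition e_fun :: "complex \<Rightarrow> complex" where
  "e_fun x = exp (2 * of_real pi * \<i> * x)"

text \<open>The division is exact for every integer \<open>k\<close>, negative ones included.\<close>
definition triangular :: "int \<Rightarrow> int" where
  "triangular k = k * (k + 1) div 2"

text \<open>The function \<open>b\<^sub>\<alpha>\<close>, written in terms of an integer \<open>u\<close> representing the residue
  class \<open>\<alpha>\<close> modulo \<open>2 h\<close>; lemma \<open>b_fun_cong\<close> below shows that only the class matters.\<close>
definition b_fun :: "nat \<Rightarrow> int \<Rightarrow> int \<Rightarrow> complex" where
  "b_fun h u m =
     (if odd m then e_fun (of_int (u * triangular ((m - 1) div 2)) / of_nat h) else 0)"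

lemma b_fun_odd: "b_fun h u (2 * k + 1) = e_fun (of_int (u * triangular k) / of_nat h)"
  and b_fun_even: "b_fun h u (2 * k) = 0"
  by (simp_all add: b_fun_def)

lemma e_fun_add_of_int: "e_fun (x + of_int n) = e_fun x"
proof -
  have "e_fun (x + of_int n) = e_fun x * exp (\<i> * (of_int n * (of_real pi * 2)))"
    by (simp only: e_fun_def exp_add [symmetric]) (simp only: algebra_simps)
  then show ?thesis
    by (simp only: exp_2pi_1_int mult_1_right)
qed

lemma e_fun_div_cong:
  assumes "h > 0" "[a = b] (mod int h)"
  shows "e_fun (of_int a / of_nat h) = e_fun (of_int b / of_nat h)"
proof -
  obtain c where "a = b + int h * c"
    using assms(2) by (metis cong_iff_lin cong_sym)
  then have "(of_int a / of_nat h :: complex) = of_int b / of_nat h + of_int c"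
    using assms(1) by (simp add: field_simps)
  then show ?thesis
    by (simp add: e_fun_add_of_int)
qed

lemma b_fun_cong:
  assumes "h > 0" "[u = v] (mod (2 * int h))"
  shows "b_fun h u m = b_fun h v m"
proof -
  have "[u = v] (mod int h)"
    using assms(2) by (metis cong_modulus_mult mult.commute)
  then show ?thesis
    unfolding b_fun_def
    using e_fun_div_cong [OF assms(1) cong_mult [OF _ cong_refl]] by presburger
qed

lemma b_fun_periodic:
  assumes "h > 0"
  shows "b_fun h u (m + 4 * int h) = b_fun h u m"
proof (cases "odd m")
  case True
  then obtain k where m: "m = 2 * k + 1"
    by (elim oddE)
  have "(k + 2 * int h) * (k + 2 * int h + 1) = k * (k + 1) + 2 * (int h * (2 * k + 2 * int h + 1))"
    by (simp add: algebra_simps)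
  then have "triangular (k + 2 * int h) = triangular k + int h * (2 * k + 2 * int h + 1)"
    by (simp add: triangular_def)
  then have "[u * triangular (k + 2 * int h) = u * triangular k] (mod int h)"
    by (simp add: cong_iff_dvd_diff distrib_left [of u] mult.left_commute [of u "int h"]
        del: distrib_left_numeral)
  moreover have "m + 4 * int h = 2 * (k + 2 * int h) + 1"
    using m by simp
  ultimately show ?thesis
    unfolding m by (metis b_fun_odd e_fun_div_cong [OF assms] m)
qed (simp add: b_fun_def)

text \<open>The Hurwitz zeta function \<open>\<zeta>(s, a)\<close>, for \<open>a > 0\<close>: the analytic continuation to
  \<open>\<complex> - {1}\<close> of \<open>\<Sum>n\<ge>0. (n + a) powr (-s)\<close>. By the identity theorem (lemma
  \<open>is_hurwitz_zeta_unique\<close>) the choice operator has no freedom at \<open>s \<noteq> 1\<close>; the value at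
  the pole is unspecified.\<close>
definition is_hurwitz_zeta :: "real \<Rightarrow> (complex \<Rightarrow> complex) \<Rightarrow> bool" where
  "is_hurwitz_zeta a f \<longleftrightarrow> f holomorphic_on (- {1}) \<and>
     (\<forall>s. Re s > 1 \<longrightarrow> (\<lambda>n. complex_of_real (real n + a) powr (- s)) sums f s)"

definition hurwitz_zeta :: "complex \<Rightarrow> real \<Rightarrow> complex" where
  "hurwitz_zeta s a = (SOME f. is_hurwitz_zeta a f) s"

lemma is_hurwitz_zeta_unique:
  assumes f: "is_hurwitz_zeta a f" and g: "is_hurwitz_zeta a g" and "s \<noteq> 1"
  shows "f s = g s"
proof (rule analytic_continuation_open [of "{s. Re s > 1}" "- {1}" f g s])
  show "connected (- {1 :: complex})"
    by (rule connected_punctured_universe) simp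
  show "{s. Re s > 1} \<noteq> {}"
    by (auto intro: exI [of _ 2])
qed (use assms in \<open>auto simp: is_hurwitz_zeta_def open_halfspace_Re_gt intro: sums_unique2\<close>)

definition hurwitz_sum :: "nat \<Rightarrow> int \<Rightarrow> complex \<Rightarrow> complex" where
  "hurwitz_sum h u s = of_nat (4 * h) powr (- s) *
     (\<Sum>r = 1..4 * h. b_fun h u (int r) * hurwitz_zeta s (real r / real (4 * h)))"

text \<open>\<open>L(s, b\<^sub>\<alpha>)\<close> with \<open>u\<close> representing \<open>\<alpha>\<close>: the Dirichlet series where it converges
  absolutely, elsewhere its continuation by Hurwitz zeta functions. At \<open>s = 1\<close> the poles of
  the summands cancel, so the continuation takes the limit value there.\<close>
definition L_fun :: "nat \<Rightarrow> int \<Rightarrow> complex \<Rightarrow> complex" where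
  "L_fun h u s =
     (if Re s > 1 then \<Sum>m. b_fun h u (int (Suc m)) * of_nat (Suc m) powr (- s)
      else if s = 1 then Lim (at 1) (hurwitz_sum h u)
      else hurwitz_sum h u s)"

end

theory Submission
  imports Defs
begin

text \<open>
  The idea is that of the functional equation: up to non-zero factors, \<open>L(-2n-1, b\<^sub>\<alpha>)\<close> is the value at
  \<open>2n+2\<close> of the Dirichlet series whose coefficients are the finite Fourier transform \<open>c(j)\<close> of \<open>b\<^sub>\<alpha>\<close>
  modulo \<open>4h\<close>. That value lies in the region of absolute convergence, where the first term can
  dominate.

  The transform \<open>c(j)\<close> is, up to a factor of modulus 1, the Gauss sum of
  \<open>exp (2 \<pi> \<i> (u k\<^sup>2 + (u + j) k) / 2h)\<close> over \<open>k\<close> modulo \<open>2h\<close>. Shifting \<open>k\<close> by \<open>c\<close> replaces \<open>j\<close> by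
  \<open>j + 2uc\<close> at the cost of a factor of modulus 1 (\<open>gauss_sum_shift\<close>). The shift by \<open>h\<close>
  shows that the sum vanishes for even \<open>j\<close>; as \<open>u\<close> is invertible, the other shifts show that its modulus
  is the same for all odd \<open>j\<close>. This modulus is not 0, since \<open>b\<^sub>\<alpha>\<close> is not identically 0
  (\<open>gauss_sum_1_nonzero\<close>). So \<open>\<bar>c(j)\<bar> \<le> \<bar>c(1)\<bar> \<noteq> 0\<close> for all \<open>j\<close>, and
  \<open>\<Sum>j\<ge>1. c(j) / j ^ (2n+2)\<close> is not 0 because \<open>\<Sum>j\<ge>2. 1 / j\<^sup>2 < 1\<close>
  (\<open>dirichlet_series_nonzero\<close>).

  The link between the two sides is made at the single point \<open>-2n-1\<close>, by Bernoulli polynomials. The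
  Euler--Maclaurin formula, with plain Taylor remainders in place of integrals, continues the Hurwitz
  zeta function to the whole plane; at \<open>s = -m\<close> all remainders vanish, which gives
  \<open>\<zeta>(-m, a) = - B\<^bsub>m+1\<^esub>(a) / (m + 1)\<close> (\<open>hurwitz_zeta_neg_nat\<close>). On \<open>[0, 1]\<close> the polynomial
  \<open>B\<^bsub>2n+2\<^esub>\<close> is, up to constants, the cosine series with coefficients \<open>1 / j ^ (2n+2)\<close>
  (\<open>bernoulli_poly_fourier_series\<close>), and summing \<open>b\<^sub>\<alpha>(r)\<close> against
  \<open>cos (2 \<pi> j r / 4h)\<close> yields \<open>c(j)\<close>, because \<open>b\<^sub>\<alpha>\<close> is even (\<open>b_dft_series\<close>).
\<close>

section \<open>Bernoulli polynomials\<close>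

text \<open>The number \<open>B\<^sub>k / k!\<close>, where \<open>B\<^sub>k\<close> is the Bernoulli number with \<open>B\<^sub>1 = -1/2\<close>.\<close>
fun bernoulli_coeff :: "nat \<Rightarrow> real" where
  "bernoulli_coeff k =
     (if k = 0 then 1 else - (\<Sum>i<k. bernoulli_coeff i / fact (Suc k - i)))"

declare bernoulli_coeff.simps [simp del]

text \<open>This is \<open>B\<^sub>k(x) / k!\<close>; with this normalisation differentiation just lowers the index.\<close>
definition bernoulli_poly :: "nat \<Rightarrow> real \<Rightarrow> real" where
  "bernoulli_poly k x = (\<Sum>i\<le>k. bernoulli_coeff i * x ^ (k - i) / fact (k - i))"

lemma bernoulli_coeff_0 [simp]: "bernoulli_coeff 0 = 1"
  by (simp add: bernoulli_coeff.simps)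

lemma bernoulli_coeff_convolution:
  "(\<Sum>i<k. bernoulli_coeff i / fact (k - i)) = (if k = 1 then 1 else 0)"
proof (cases k)
  case (Suc m)
  show ?thesis
  proof (cases "m = 0")
    case False
    then have "bernoulli_coeff m = - (\<Sum>i<m. bernoulli_coeff i / fact (Suc m - i))"
      by (subst bernoulli_coeff.simps) simp
    then show ?thesis
      using False Suc by simp
  qed (use Suc in simp)
qed simp

lemma bernoulli_poly_1: "bernoulli_poly 1 x = x - 1 / 2"
proof -
  have "bernoulli_coeff 1 = - (1 / 2)"
    by (subst bernoulli_coeff.simps) (simp add: numeral_2_eq_2)
  then show ?thesis
    by (simp add: bernoulli_poly_def)
qed

lemma bernoulli_poly_has_derivative:
  "(bernoulli_poly (Suc k) has_real_derivative bernoulli_poly k x) (at x within S)"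
proof -
  let ?f = "\<lambda>x. (\<Sum>i\<le>k. bernoulli_coeff i / fact (Suc (k - i)) * x ^ Suc (k - i))
    + bernoulli_coeff (Suc k)"
  have "bernoulli_poly (Suc k) x = ?f x" for x
    unfolding bernoulli_poly_def sum.atMost_Suc
    by (intro arg_cong2 [where f = "(+)"] sum.cong) (auto simp: Suc_diff_le)
  then have eq: "bernoulli_poly (Suc k) = ?f"
    by (rule ext)
  have "(?f has_real_derivative
      (\<Sum>i\<le>k. bernoulli_coeff i / fact (Suc (k - i)) * (real (Suc (k - i)) * x ^ (k - i))) + 0)
      (at x within S)"
  proof (intro DERIV_add DERIV_sum DERIV_cmult DERIV_const)
    show "((\<lambda>x. x ^ Suc m) has_real_derivative real (Suc m) * x ^ m) (at x within S)" for m
      using DERIV_pow [of "Suc m" x] by simp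
  qed
  also have "(\<Sum>i\<le>k. bernoulli_coeff i / fact (Suc (k - i)) * (real (Suc (k - i)) * x ^ (k - i))) + 0
      = bernoulli_poly k x"
  proof -
    have "b / fact (Suc m) * (real (Suc m) * y) = b * y / fact m" for b y :: real and m
    proof -
      have "b / (r * F) * (r * y) = b * y / F" if "r \<noteq> 0" for r F :: real
        using that by simp
      then show ?thesis
        by (simp only: fact_Suc of_nat_eq_0_iff nat.distinct not_False_eq_True)
    qed
    then show ?thesis
      by (simp only: bernoulli_poly_def add_0_right)
  qed
  finally show ?thesis
    by (simp only: eq)
qed

lemma bernoulli_poly_endpoints:
  assumes "k \<ge> 2"
  shows "bernoulli_poly k 1 = bernoulli_poly k 0"
proof -
  have "bernoulli_poly k 1 = (\<Sum>i<k. bernoulli_coeff i / fact (k - i)) + bernoulli_coeff k"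
    by (simp add: bernoulli_poly_def lessThan_Suc_atMost [symmetric])
  moreover have "bernoulli_poly k 0 = (\<Sum>i\<le>k. if i = k then bernoulli_coeff k else 0)"
    unfolding bernoulli_poly_def by (intro sum.cong) auto
  ultimately show ?thesis
    using assms by (simp add: bernoulli_coeff_convolution)
qed

section \<open>The Hurwitz zeta function by Euler--Maclaurin summation\<close>

text \<open>With these coefficients, the functions \<open>em_deriv k s\<close> are the antiderivative of \<open>z powr (-s)\<close> (for \<open>k = 0\<close>), the
  function itself (for \<open>k = 1\<close>) and its successive derivatives.\<close>
definition em_coeff :: "nat \<Rightarrow> complex \<Rightarrow> complex" where
  "em_coeff k s = (if k = 0 then 1 / (1 - s) else \<Prod>i<k - 1. - s - of_nat i)"

definition em_deriv :: "nat \<Rightarrow> complex \<Rightarrow> complex \<Rightarrow> complex" where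
  "em_deriv k s z = em_coeff k s * z powr (1 - s - of_nat k)"

lemma em_deriv_1: "em_deriv 1 s z = z powr (- s)"
  by (simp add: em_deriv_def em_coeff_def)

lemma em_coeff_Suc:
  assumes "s \<noteq> 1"
  shows "em_coeff (Suc k) s = (1 - s - of_nat k) * em_coeff k s"
  using assms by (cases k) (auto simp: em_coeff_def algebra_simps)

lemma em_deriv_has_derivative:
  assumes "s \<noteq> 1" "Re z > 0"
  shows "(em_deriv k s has_field_derivative em_deriv (Suc k) s z) (at z within S)"
proof -
  have "z \<notin> \<real>\<^sub>\<le>\<^sub>0"
    using assms(2) complex_nonpos_Reals_iff by auto
  then have "((\<lambda>z. em_coeff k s * z powr (1 - s - of_nat k)) has_field_derivative
      em_coeff k s * ((1 - s - of_nat k) * z powr (1 - s - of_nat k - 1))) (at z)"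
    by (intro DERIV_cmult has_field_derivative_powr)
  also have "em_coeff k s * ((1 - s - of_nat k) * z powr (1 - s - of_nat k - 1)) = em_deriv (Suc k) s z"
    by (simp add: em_deriv_def em_coeff_Suc [OF assms(1)] diff_diff_eq mult_ac add_ac)
  finally show ?thesis
    by (simp add: em_deriv_def [abs_def] has_field_derivative_at_within)
qed

lemma norm_powr_of_real:
  assumes "x > 0"
  shows "norm (complex_of_real x powr s) = x powr Re s"
  using assms by (simp add: norm_powr_real_powr)

lemma em_deriv_Taylor:
  assumes "s \<noteq> 1" "x > 0" "k \<le> K" "Re s + real K \<ge> 0"
  shows "norm (em_deriv k s (of_real (x + 1)) -
      (\<Sum>i\<le>K - k. em_deriv (k + i) s (of_real x) / fact i))
    \<le> norm (em_coeff (Suc K) s) * x powr (- Re s - real K)"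
proof -
  \<comment> \<open>On the real axis the modulus of a complex power depends on the real part of the exponent only.\<close>
  let ?S = "closed_segment (complex_of_real x) (of_real (x + 1))"
  let ?B = "norm (em_coeff (Suc K) s) * x powr (- Re s - real K)"
  have seg: "\<exists>y. w = of_real y \<and> x \<le> y" if "w \<in> ?S" for w
    using that unfolding closed_segment_of_real closed_segment_eq_real_ivl by auto
  have "norm (em_deriv (k + 0) s (of_real (x + 1)) -
      (\<Sum>i\<le>K - k. em_deriv (k + i) s (of_real x) * (of_real (x + 1) - of_real x) ^ i / fact i))
      \<le> ?B * norm (complex_of_real (x + 1) - of_real x) ^ Suc (K - k) / fact (K - k)"
  proof (rule complex_Taylor [where f = "\<lambda>i. em_deriv (k + i) s" and S = ?S])
    show "(em_deriv (k + i) s has_field_derivative em_deriv (k + Suc i) s w) (at w within ?S)"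
      if w: "w \<in> ?S" for i w
    proof -
      have "Re w > 0"
        using seg [OF w] assms(2) by auto
      then show ?thesis
        using em_deriv_has_derivative [OF assms(1), of w "k + i"] by simp
    qed
    show "norm (em_deriv (k + Suc (K - k)) s w) \<le> ?B" if w: "w \<in> ?S" for w
    proof -
      obtain y where y: "w = of_real y" "x \<le> y"
        using seg [OF w] by blast
      have "norm (em_deriv (Suc K) s w) = norm (em_coeff (Suc K) s) * y powr (- Re s - real K)"
        using y assms(2) by (simp add: em_deriv_def norm_mult norm_powr_of_real)
      also have "y powr (- Re s - real K) \<le> x powr (- Re s - real K)"
        using y assms(2,4) by (intro powr_mono2') auto
      finally show ?thesis
        using assms(3) by (simp add: mult_left_mono)
    qed
  qed (auto simp: convex_closed_segment)
  also have "\<dots> = ?B / fact (K - k)"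
    by simp
  also have "\<dots> \<le> ?B / 1"
    by (intro divide_left_mono) (auto simp: fact_ge_1)
  finally show ?thesis
    by simp
qed

text \<open>The truncation at order \<open>K\<close> of the Euler--Maclaurin antidifference
  \<open>\<Sum>k. B\<^sub>k / k! * (d / dz) ^ (k - 1)\<close>, applied to \<open>z powr (-s)\<close>.\<close>
definition em_main :: "nat \<Rightarrow> complex \<Rightarrow> complex \<Rightarrow> complex" where
  "em_main K s z = (\<Sum>k\<le>K. of_real (bernoulli_coeff k) * em_deriv k s z)"

definition em_error :: "nat \<Rightarrow> complex \<Rightarrow> complex \<Rightarrow> complex" where
  "em_error K s z = em_main K s (z + 1) - em_main K s z - z powr (- s)"

text \<open>Expanding every term of \<open>em_main K s (x + 1)\<close> around \<open>x\<close>, the coefficient of the derivative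
  with index \<open>m\<close> in \<open>em_main K s (x + 1) - em_main K s x\<close> is the Bernoulli convolution sum, which
  leaves only the term with \<open>m = 1\<close>, that is \<open>x powr (-s)\<close>. So the error consists of Taylor
  remainders only.\<close>
lemma em_error_bound:
  assumes "s \<noteq> 1" "x > 0" "K \<ge> 1" "Re s + real K \<ge> 0"
  shows "norm (em_error K s (of_real x))
    \<le> (\<Sum>k\<le>K. \<bar>bernoulli_coeff k\<bar>) * norm (em_coeff (Suc K) s) * x powr (- Re s - real K)"
proof -
  let ?g = "\<lambda>k. em_deriv k s (of_real x)"
  let ?b = "\<lambda>k. complex_of_real (bernoulli_coeff k)"
  let ?T = "\<lambda>k. \<Sum>i\<le>K - k. ?g (k + i) / fact i"
  have T: "?T k = (\<Sum>m=k..K. ?g m / fact (m - k))" if "k \<le> K" for k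
    by (rule sum.reindex_bij_witness [of _ "\<lambda>m. m - k" "\<lambda>i. k + i"]) (use that in auto)
  have "(\<Sum>k\<le>K. ?b k * ?T k) = (\<Sum>k\<le>K. \<Sum>m=k..K. ?b k * ?g m / fact (m - k))"
    by (intro sum.cong) (simp_all add: T sum_distrib_left)
  also have "\<dots> = (\<Sum>k\<le>K. \<Sum>m\<in>{m\<in>{..K}. k \<le> m}. ?b k * ?g m / fact (m - k))"
    by (intro sum.cong) auto
  also have "\<dots> = (\<Sum>m\<le>K. \<Sum>k\<in>{k\<in>{..K}. k \<le> m}. ?b k * ?g m / fact (m - k))"
    by (rule sum.swap_restrict) auto
  also have "\<dots> = (\<Sum>m\<le>K. ?b m * ?g m + (\<Sum>k<m. ?b k * ?g m / fact (m - k)))"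
  proof (intro sum.cong refl)
    fix m assume "m \<in> {..K}"
    then have "{k\<in>{..K}. k \<le> m} = insert m {..<m}"
      by auto
    then show "(\<Sum>k\<in>{k\<in>{..K}. k \<le> m}. ?b k * ?g m / fact (m - k)) =
        ?b m * ?g m + (\<Sum>k<m. ?b k * ?g m / fact (m - k))"
      by simp
  qed
  also have "\<dots> = em_main K s (of_real x) + (\<Sum>m\<le>K. \<Sum>k<m. ?b k * ?g m / fact (m - k))"
    by (simp add: sum.distrib em_main_def)
  also have "(\<Sum>m\<le>K. \<Sum>k<m. ?b k * ?g m / fact (m - k)) = (\<Sum>m\<le>K. if m = 1 then ?g 1 else 0)"
  proof (intro sum.cong refl)
    fix m
    have "(\<Sum>k<m. ?b k * ?g m / fact (m - k)) =
        of_real (\<Sum>k<m. bernoulli_coeff k / fact (m - k)) * ?g m"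
      by (simp add: sum_distrib_right sum_distrib_left mult_ac)
    then show "(\<Sum>k<m. ?b k * ?g m / fact (m - k)) = (if m = 1 then ?g 1 else 0)"
      by (simp add: bernoulli_coeff_convolution)
  qed
  also have "\<dots> = of_real x powr (- s)"
    using assms(3) by (simp add: em_deriv_1 [simplified])
  finally have main: "(\<Sum>k\<le>K. ?b k * ?T k) = em_main K s (of_real x) + of_real x powr (- s)" .
  have "em_error K s (of_real x) = (\<Sum>k\<le>K. ?b k * (em_deriv k s (of_real (x + 1)) - ?T k))"
    using main by (simp add: em_error_def em_main_def [of _ _ "_ + 1"] right_diff_distrib sum_subtractf)
  also have "norm \<dots> \<le> (\<Sum>k\<le>K. norm (?b k * (em_deriv k s (of_real (x + 1)) - ?T k)))"
    by (rule norm_sum)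
  also have "\<dots> \<le> (\<Sum>k\<le>K. \<bar>bernoulli_coeff k\<bar> *
      (norm (em_coeff (Suc K) s) * x powr (- Re s - real K)))"
    unfolding norm_mult norm_of_real
    by (intro sum_mono mult_left_mono em_deriv_Taylor assms) auto
  finally show ?thesis
    by (simp add: sum_distrib_right mult.assoc)
qed

lemma em_coeff_holomorphic [holomorphic_intros]: "em_coeff k holomorphic_on - {1}"
proof (cases "k = 0")
  case True
  then have "em_coeff k = (\<lambda>s. 1 / (1 - s))"
    by (simp add: em_coeff_def fun_eq_iff)
  then show ?thesis
    by (auto intro!: holomorphic_intros)
next
  case False
  then have "em_coeff k = (\<lambda>s. \<Prod>i<k - 1. - s - of_nat i)"
    by (simp add: em_coeff_def fun_eq_iff)
  then show ?thesis
    by (auto intro!: holomorphic_intros)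
qed

lemma em_main_holomorphic: "(\<lambda>s. em_main K s z) holomorphic_on - {1}"
  unfolding em_main_def em_deriv_def by (intro holomorphic_intros)

lemma em_error_holomorphic: "(\<lambda>s. em_error K s z) holomorphic_on - {1}"
  unfolding em_error_def by (intro holomorphic_intros em_main_holomorphic)

text \<open>Summing \<open>z powr (-s) = em_main K s (z + 1) - em_main K s z - em_error K s z\<close> over \<open>z = n + a\<close>
  formally gives this expression. The series of errors converges in the half plane
  \<open>Re s > 1 - K\<close>, which is how far it continues the zeta function.\<close>
definition hurwitz_em :: "nat \<Rightarrow> real \<Rightarrow> complex \<Rightarrow> complex" where
  "hurwitz_em K a s =
     - em_main K s (of_real a) - (\<Sum>n. em_error K s (of_real (real n + a)))"

text \<open>On a compact disc in the half plane the error terms are dominated by a convergent series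
  \<open>\<Sum>n. C * n powr (-\<sigma> - K)\<close> with \<open>\<sigma> + K > 1\<close>. The domination starts at \<open>n = 1\<close>, because
  \<open>x powr (- Re s - K)\<close> is monotone in the exponent only for \<open>x \<ge> 1\<close>.\<close>
lemma em_error_uniform_limit:
  assumes "a > 0" "K \<ge> 1" and sub: "cball s0 d \<subseteq> {s. Re s > 1 - real K} - {1}" and "d > 0"
  shows "uniform_limit (cball s0 d) (\<lambda>N s. \<Sum>n<N. em_error K s (of_real (real n + a)))
           (\<lambda>s. \<Sum>n. em_error K s (of_real (real n + a))) sequentially"
proof -
  define \<sigma> where "\<sigma> = Re s0 - d"
  have "s0 - of_real d \<in> cball s0 d"
    using assms(4) by (simp add: dist_norm)
  then have \<sigma>: "\<sigma> + real K > 1"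
    using subsetD [OF sub] by (fastforce simp: \<sigma>_def)
  have "continuous_on (cball s0 d) (em_coeff (Suc K))"
    by (rule holomorphic_on_imp_continuous_on, rule holomorphic_on_subset [OF em_coeff_holomorphic])
       (use sub in auto)
  then have "bounded (em_coeff (Suc K) ` cball s0 d)"
    by (intro compact_imp_bounded compact_continuous_image compact_cball)
  then obtain B where B: "\<And>s. s \<in> cball s0 d \<Longrightarrow> norm (em_coeff (Suc K) s) \<le> B"
    unfolding bounded_iff by (meson imageI)
  let ?M = "\<lambda>n. (\<Sum>k\<le>K. \<bar>bernoulli_coeff k\<bar>) * B * real n powr (- \<sigma> - real K)"
  show ?thesis
  proof (rule Weierstrass_m_test_ev)
    show "\<forall>\<^sub>F n in sequentially. \<forall>s\<in>cball s0 d. norm (em_error K s (of_real (real n + a))) \<le> ?M n"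
    proof (rule eventually_sequentiallyI [of 1], intro ballI)
      fix n :: nat and s assume n: "n \<ge> 1" and s: "s \<in> cball s0 d"
      have "\<bar>Re (s0 - s)\<bar> \<le> norm (s0 - s)"
        by (rule abs_Re_le_cmod)
      then have Re: "Re s \<ge> \<sigma>"
        using s by (simp add: \<sigma>_def dist_norm)
      have "s \<noteq> 1"
        using s sub by auto
      then have "norm (em_error K s (of_real (real n + a))) \<le> (\<Sum>k\<le>K. \<bar>bernoulli_coeff k\<bar>) *
          norm (em_coeff (Suc K) s) * (real n + a) powr (- Re s - real K)"
        by (rule em_error_bound) (use assms Re \<sigma> in auto)
      also have "\<dots> \<le> (\<Sum>k\<le>K. \<bar>bernoulli_coeff k\<bar>) * B * (real n + a) powr (- Re s - real K)"
        using B [OF s] by (intro mult_right_mono mult_left_mono) (auto simp: sum_nonneg)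
      also have "(real n + a) powr (- Re s - real K) \<le> real n powr (- Re s - real K)"
        using n assms Re \<sigma> by (intro powr_mono2') auto
      also have "real n powr (- Re s - real K) \<le> real n powr (- \<sigma> - real K)"
        using n Re by (intro powr_mono) auto
      finally show "norm (em_error K s (of_real (real n + a))) \<le> ?M n"
        using order_trans [OF norm_ge_zero B [OF s]] by (simp add: mult_left_mono sum_nonneg)
    qed
    show "summable ?M"
      using \<sigma> by (intro summable_mult) (simp add: summable_real_powr_iff)
  qed
qed

lemma em_domain_open: "open ({s. Re s > r} - {1 :: complex})"
  by (intro open_Diff open_halfspace_Re_gt) auto

lemma em_domain_cball:
  assumes "s \<in> {s. Re s > r} - {1 :: complex}"
  obtains d where "d > 0" "cball s d \<subseteq> {s. Re s > r} - {1}"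
  using assms em_domain_open open_contains_cball by blast

lemma hurwitz_em_holomorphic:
  assumes "a > 0" "K \<ge> 1"
  shows "hurwitz_em K a holomorphic_on {s. Re s > 1 - real K} - {1}"
proof -
  have "(\<lambda>s. \<Sum>n. em_error K s (of_real (real n + a))) holomorphic_on {s. Re s > 1 - real K} - {1}"
  proof (rule holomorphic_uniform_sequence
      [where f = "\<lambda>N s. \<Sum>n<N. em_error K s (of_real (real n + a))"])
    show "(\<lambda>s. \<Sum>n<N. em_error K s (of_real (real n + a))) holomorphic_on {s. Re s > 1 - real K} - {1}"
      for N by (intro holomorphic_intros holomorphic_on_subset [OF em_error_holomorphic]) auto
    show "\<exists>d. 0 < d \<and> cball s d \<subseteq> {s. Re s > 1 - real K} - {1} \<and>
        uniform_limit (cball s d) (\<lambda>N s. \<Sum>n<N. em_error K s (of_real (real n + a)))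
          (\<lambda>s. \<Sum>n. em_error K s (of_real (real n + a))) sequentially"
      if "s \<in> {s. Re s > 1 - real K} - {1}" for s
      using em_domain_cball [OF that] em_error_uniform_limit [OF assms] by metis
  qed (rule em_domain_open)
  moreover have "(\<lambda>s. em_main K s (of_real a)) holomorphic_on {s. Re s > 1 - real K} - {1}"
    by (rule holomorphic_on_subset [OF em_main_holomorphic]) auto
  ultimately show ?thesis
    unfolding hurwitz_em_def [abs_def] by (intro holomorphic_intros)
qed

text \<open>For \<open>Re s > 1\<close> the values of \<open>em_main\<close> at \<open>n + a\<close> tend to 0, so that the telescoping
  sum of its differences is \<open>- em_main K s a\<close>.\<close>
lemma hurwitz_em_sums:
  assumes "a > 0" "K \<ge> 1" "Re s > 1"
  shows "(\<lambda>n. complex_of_real (real n + a) powr (- s)) sums hurwitz_em K a s"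
proof -
  have "s \<in> {s. Re s > 1 - real K} - {1}"
    using assms by auto
  then obtain d where "d > 0" "cball s d \<subseteq> {s. Re s > 1 - real K} - {1}"
    by (rule em_domain_cball)
  then have "((\<lambda>N. \<Sum>n<N. em_error K s (of_real (real n + a))) \<longlongrightarrow>
      (\<Sum>n. em_error K s (of_real (real n + a)))) sequentially"
    by (intro tendsto_uniform_limitI [OF em_error_uniform_limit [OF assms(1,2)]]) auto
  then have error: "(\<lambda>n. em_error K s (of_real (real n + a))) sums
      (\<Sum>n. em_error K s (of_real (real n + a)))"
    by (simp add: sums_def)
  have lim: "(\<lambda>n. em_main K s (of_real (real n + a))) \<longlonglongrightarrow> 0"
    unfolding em_main_def
  proof (rule tendsto_null_sum)
    fix k
    have "(\<lambda>n. (real n + a) powr (1 - Re s - real k)) \<longlonglongrightarrow> 0"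
      using assms(3)
      by (intro tendsto_neg_powr) (auto simp: add.commute [of _ a]
            intro!: filterlim_tendsto_add_at_top [OF tendsto_const] filterlim_real_sequentially)
    then have "(\<lambda>n. complex_of_real (real n + a) powr (1 - s - of_nat k)) \<longlonglongrightarrow> 0"
      using assms(1) by (subst tendsto_norm_zero_iff [symmetric]) (simp add: norm_powr_of_real del: of_real_add)
    then show "(\<lambda>n. of_real (bernoulli_coeff k) * em_deriv k s (of_real (real n + a))) \<longlonglongrightarrow> 0"
      unfolding em_deriv_def by (intro tendsto_mult_right_zero)
  qed
  have "(\<lambda>n. em_main K s (of_real (real (Suc n) + a)) - em_main K s (of_real (real n + a))) sums
      (0 - em_main K s (of_real (real 0 + a)))"
    by (rule telescope_sums [OF lim])
  from sums_diff [OF this error] show ?thesis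
    by (simp add: hurwitz_em_def em_error_def add_ac)
qed

text \<open>Different truncation orders continue the same Dirichlet series, so they agree wherever both
  make sense, and letting the order grow with \<open>- Re s\<close> glues them to a function on \<open>\<complex> - {1}\<close>.\<close>
lemma hurwitz_em_agree:
  assumes "a > 0" "1 \<le> K" "K \<le> K'" "s \<noteq> 1" "Re s > 1 - real K"
  shows "hurwitz_em K a s = hurwitz_em K' a s"
proof (rule analytic_continuation_open
    [of "{s. Re s > 1}" "{s. Re s > 1 - real K} - {1}" "hurwitz_em K a" "hurwitz_em K' a"])
  show "connected ({s. Re s > 1 - real K} - {1 :: complex})"
    by (intro connected_open_delete open_halfspace_Re_gt convex_connected convex_halfspace_Re_gt) simp
  show "{s. Re s > 1} \<noteq> {}"
    by (auto intro: exI [of _ 2])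
  show "hurwitz_em K' a holomorphic_on {s. Re s > 1 - real K} - {1}"
    by (rule holomorphic_on_subset [OF hurwitz_em_holomorphic]) (use assms in auto)
  show "hurwitz_em K a s = hurwitz_em K' a s" if "s \<in> {s. Re s > 1}" for s
    using that assms by (intro sums_unique2 [OF hurwitz_em_sums hurwitz_em_sums]) auto
qed (use assms in \<open>auto simp: open_halfspace_Re_gt em_domain_open hurwitz_em_holomorphic\<close>)

lemma is_hurwitz_zeta_ex:
  assumes "a > 0"
  shows "\<exists>f. is_hurwitz_zeta a f"
proof
  \<comment> \<open>Any choice with \<open>?K s \<ge> 1\<close> and \<open>?K s > 1 - Re s\<close> serves here.\<close>
  let ?K = "\<lambda>s. nat \<lceil>2 + \<bar>Re s\<bar>\<rceil>"
  let ?F = "\<lambda>s. hurwitz_em (?K s) a s"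
  have K: "?K s \<ge> 1" "Re s > 1 - real (?K s)" for s
    by linarith+
  have F: "?F s = hurwitz_em K a s" if "K \<ge> 1" "s \<in> {s. Re s > 1 - real K} - {1}" for K s
  proof (cases "K \<le> ?K s")
    case True
    then show ?thesis
      using hurwitz_em_agree [of a K "?K s" s] assms that by simp
  next
    case False
    then have "?K s \<le> K"
      by (rule less_imp_le [OF not_le_imp_less])
    then show ?thesis
      by (rule hurwitz_em_agree [OF assms K(1) _ _ K(2)]) (use that in simp)
  qed
  show "is_hurwitz_zeta a ?F"
    unfolding is_hurwitz_zeta_def
  proof (intro conjI allI impI)
    show "?F holomorphic_on - {1}"
      unfolding holomorphic_on_def
    proof
      fix s :: complex assume s: "s \<in> - {1}"
      let ?D = "{z. Re z > 1 - real (?K s)} - {1 :: complex}"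
      have "hurwitz_em (?K s) a holomorphic_on ?D"
        by (rule hurwitz_em_holomorphic [OF assms K(1)])
      then have "?F holomorphic_on ?D"
        by (rule holomorphic_transform) (use F [OF K(1)] in auto)
      then have "?F field_differentiable at s"
        by (rule holomorphic_on_imp_differentiable_at [OF _ em_domain_open]) (use s K in auto)
      then show "?F field_differentiable at s within - {1}"
        by (rule field_differentiable_at_within)
    qed
    show "(\<lambda>n. complex_of_real (real n + a) powr (- s)) sums ?F s" if "Re s > 1" for s
      using hurwitz_em_sums [OF assms K(1) that] .
  qed
qed

lemma hurwitz_zeta_eq_hurwitz_em:
  assumes "a > 0" "K \<ge> 1" "s \<noteq> 1" "Re s > 1 - real K"
  shows "hurwitz_zeta s a = hurwitz_em K a s"
proof (unfold hurwitz_zeta_def, rule analytic_continuation_open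
    [of "{s. Re s > 1}" "{s. Re s > 1 - real K} - {1}" _ "hurwitz_em K a"])
  let ?f = "SOME f. is_hurwitz_zeta a f"
  have f: "is_hurwitz_zeta a ?f"
    using is_hurwitz_zeta_ex [OF assms(1)] by (rule someI_ex)
  show "connected ({s. Re s > 1 - real K} - {1 :: complex})"
    by (intro connected_open_delete open_halfspace_Re_gt convex_connected convex_halfspace_Re_gt) simp
  show "{s. Re s > 1} \<noteq> {}"
    by (auto intro: exI [of _ 2])
  show "?f holomorphic_on {s. Re s > 1 - real K} - {1}"
    using f by (auto simp: is_hurwitz_zeta_def intro: holomorphic_on_subset)
  show "?f s = hurwitz_em K a s" if "s \<in> {s. Re s > 1}" for s
    using f that assms by (auto simp: is_hurwitz_zeta_def intro!: sums_unique2 [OF _ hurwitz_em_sums])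
qed (use assms in \<open>auto simp: open_halfspace_Re_gt em_domain_open hurwitz_em_holomorphic\<close>)

text \<open>At \<open>s = -m\<close> the summand \<open>z ^ m\<close> is a polynomial, its Taylor expansions terminate, and all error
  terms vanish. Only \<open>- em_main\<close> remains, which is classically \<open>- B\<^bsub>m+1\<^esub>(a) / (m + 1)\<close>.\<close>
theorem hurwitz_zeta_neg_nat:
  assumes "a > 0"
  shows "hurwitz_zeta (- of_nat m) a = - of_real (fact m * bernoulli_poly (Suc m) a)"
proof -
  \<comment> \<open>The order \<open>m + 2\<close> is the least one whose half plane \<open>Re s > 1 - K\<close> contains \<open>-m\<close>.\<close>
  let ?K = "m + 2" and ?s = "- of_nat m :: complex"
  have ne: "?s \<noteq> 1"
    by (metis of_nat_Suc add.commute neg_eq_iff_add_eq_0 of_nat_eq_0_iff nat.distinct(1) add.inverse_inverse)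
  have prod0: "(\<Prod>i<k. of_nat m - of_nat i :: complex) = 0" if "m < k" for k
    using that by (intro prod_zero) (auto intro!: bexI [of _ m])
  have prod: "(\<Prod>i<k. of_nat m - of_nat i :: complex) = fact m / fact (m - k)" if "k \<le> m" for k
    using that
  proof (induction k)
    case (Suc k)
    have "m - k = Suc (m - Suc k)"
      using Suc.prems by simp
    then have fact: "fact (m - k) = (of_nat (m - k) :: complex) * fact (m - Suc k)"
      by (metis fact_Suc)
    have diff: "of_nat m - of_nat k = (of_nat (m - k) :: complex)"
      using Suc.prems by simp
    have cancel: "F / (x * G) * x = F / G" if "x \<noteq> 0" for x F G :: complex
      using that by simp
    have "of_nat (m - k) \<noteq> (0 :: complex)"
      using Suc.prems by (simp only: of_nat_eq_0_iff)
    from cancel [OF this] show ?case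
      using Suc.prems by (simp only: prod.lessThan_Suc Suc.IH [OF Suc_leD] diff fact)
  qed simp
  have error: "em_error ?K ?s (of_real x) = 0" if "x > 0" for x
  proof -
    have "em_coeff (Suc ?K) ?s = 0"
      using prod0 [of "m + 2"] by (simp add: em_coeff_def)
    then show ?thesis
      using em_error_bound [OF ne that, of ?K] by simp
  qed
  have main: "em_deriv k ?s (of_real a) =
      (if k \<le> Suc m then fact m * of_real (a ^ (Suc m - k) / fact (Suc m - k)) else 0)" for k
  proof (cases "k \<le> Suc m")
    case True
    have "em_coeff k ?s = fact m / fact (Suc m - k)"
    proof (cases k)
      case 0
      have "fact m / fact (Suc m) = (1 / (1 + of_nat m) :: complex)"
        by (simp add: fact_Suc)
      then show ?thesis
        using 0 by (simp add: em_coeff_def)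
    next
      case (Suc j)
      then show ?thesis
        using prod [of j] True by (simp add: em_coeff_def)
    qed
    moreover have "of_real a powr (1 - ?s - of_nat k) = complex_of_real a ^ (Suc m - k)"
    proof -
      have "1 - ?s - of_nat k = of_nat (Suc m - k)"
        using True by (simp add: of_nat_diff)
      then show ?thesis
        using assms by (simp only: powr_nat' of_real_eq_0_iff) simp
    qed
    ultimately show ?thesis
      using True by (simp only: em_deriv_def) simp
  next
    case False
    then have "em_coeff k ?s = 0"
      using prod0 [of "k - 1"] by (simp add: em_coeff_def)
    with False show ?thesis
      by (simp only: em_deriv_def) simp
  qed
  have "em_main ?K ?s (of_real a) =
      (\<Sum>k\<le>Suc m. of_real (bernoulli_coeff k) * em_deriv k ?s (of_real a))"
    unfolding em_main_def by (intro sum.mono_neutral_right) (auto simp: main)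
  also have "\<dots> = (\<Sum>k\<le>Suc m. fact m *
      of_real (bernoulli_coeff k * a ^ (Suc m - k) / fact (Suc m - k)))"
    by (intro sum.cong refl) (simp add: main)
  also have "\<dots> = of_real (fact m * bernoulli_poly (Suc m) a)"
    by (simp only: bernoulli_poly_def of_real_mult of_real_sum of_real_fact sum_distrib_left)
  finally have main_value: "em_main ?K ?s (of_real a) = of_real (fact m * bernoulli_poly (Suc m) a)" .
  have "hurwitz_zeta ?s a = hurwitz_em ?K a ?s"
    by (rule hurwitz_zeta_eq_hurwitz_em) (use assms ne in auto)
  also have "\<dots> = - em_main ?K ?s (of_real a)"
  proof -
    have "em_error ?K ?s (of_real (real n + a)) = 0" for n
      by (rule error) (use assms in simp)
    then show ?thesis
      by (simp only: hurwitz_em_def suminf_zero diff_zero)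
  qed
  finally show ?thesis
    by (simp only: main_value)
qed

section \<open>Fourier series of Bernoulli polynomials\<close>

text \<open>This is the sum of the terms with index \<open>j\<close> and \<open>-j\<close> in the series
  \<open>\<Sum>\<^sub>j exp (2 \<pi> \<i> j x) / (2 \<pi> \<i> j) ^ k\<close>; the shift by \<open>k \<pi> / 2\<close> stands for the factor \<open>\<i> ^ (-k)\<close>.\<close>
definition fourier_term :: "nat \<Rightarrow> nat \<Rightarrow> real \<Rightarrow> real" where
  "fourier_term k j x = 2 * cos (2 * pi * real j * x - real k * pi / 2) / (2 * pi * real j) ^ k"

lemma fourier_term_1: "fourier_term 1 j x = sin (2 * pi * real j * x) / (pi * real j)"
proof -
  have "cos (2 * pi * real j * x - real 1 * pi / 2) = sin (2 * pi * real j * x)"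
    by (simp add: cos_diff)
  then show ?thesis
    by (simp add: fourier_term_def)
qed

lemma fourier_term_has_derivative:
  assumes "j > 0"
  shows "(fourier_term (Suc k) j has_real_derivative fourier_term k j x) (at x within S)"
proof -
  let ?t = "2 * pi * real j * x - real k * pi / 2" and ?c = "2 * pi * real j"
  have arg: "2 * pi * real j * x - real (Suc k) * pi / 2 = ?t - pi / 2"
    by (simp add: field_simps)
  have "sin (?t - pi / 2) = - cos ?t"
    by (simp add: sin_diff)
  then have sin: "- sin (2 * pi * real j * x - real (Suc k) * pi / 2) = cos ?t"
    by (simp only: arg minus_minus)
  have "?c \<noteq> 0"
    using assms by simp
  have "((\<lambda>x. 2 * cos (?c * x - real (Suc k) * pi / 2) / ?c ^ Suc k) has_real_derivative
      2 * (- sin (?c * x - real (Suc k) * pi / 2) * ?c) / ?c ^ Suc k) (at x within S)"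
    by (intro DERIV_cdivide DERIV_cmult) (auto intro!: derivative_eq_intros)
  also have "2 * (- sin (?c * x - real (Suc k) * pi / 2) * ?c) / ?c ^ Suc k = fourier_term k j x"
    unfolding sin fourier_term_def using \<open>?c \<noteq> 0\<close> by simp
  finally show ?thesis
    by (simp only: fourier_term_def [abs_def])
qed

lemma fourier_term_bound:
  assumes "k \<ge> 2"
  shows "\<bar>fourier_term k (Suc j) x\<bar> \<le> 1 / (real j + 1) ^ 2"
proof -
  let ?c = "2 * pi * real (Suc j)"
  have c: "?c \<ge> 2 * (real j + 1)" "?c \<ge> 1"
  proof -
    have "2 * 1 * real (Suc j) \<le> ?c"
      using pi_ge_two by (intro mult_right_mono mult_left_mono) auto
    then show "?c \<ge> 2 * (real j + 1)" "?c \<ge> 1"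
      by simp_all
  qed
  have "\<bar>fourier_term k (Suc j) x\<bar> =
      2 * \<bar>cos (2 * pi * real (Suc j) * x - real k * pi / 2)\<bar> / ?c ^ k"
    by (simp add: fourier_term_def abs_mult)
  also have "\<dots> \<le> 2 / ?c ^ k"
    using c by (intro divide_right_mono) auto
  also have "\<dots> \<le> 2 / (2 * (real j + 1)) ^ 2"
  proof (intro divide_left_mono)
    have "(2 * (real j + 1)) ^ 2 \<le> ?c ^ 2"
      using c by (intro power_mono) auto
    also have "\<dots> \<le> ?c ^ k"
      using c assms by (intro power_increasing) auto
    finally show "(2 * (real j + 1)) ^ 2 \<le> ?c ^ k" .
  qed (use c in auto)
  also have "\<dots> \<le> 1 / (real j + 1) ^ 2"
    by (simp add: power_mult_distrib divide_simps del: distrib_left_numeral)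
  finally show ?thesis .
qed

lemma fourier_series_uniform_limit:
  assumes "k \<ge> 2"
  shows "uniform_limit S (\<lambda>N x. \<Sum>j<N. fourier_term k (Suc j) x)
    (\<lambda>x. \<Sum>j. fourier_term k (Suc j) x) sequentially"
  by (rule Weierstrass_m_test [where M = "\<lambda>j. 1 / (real j + 1) ^ 2"])
     (use assms fourier_term_bound inverse_squares_sums in \<open>auto simp: sums_iff add.commute\<close>)

lemma fourier_series_summable:
  assumes "k \<ge> 2"
  shows "summable (\<lambda>j. fourier_term k (Suc j) x)"
  using tendsto_uniform_limitI [OF fourier_series_uniform_limit [OF assms, of UNIV], of x]
  by (auto simp: summable_def sums_def)

lemma fourier_term_period: "fourier_term k j 1 = fourier_term k j 0"
proof -
  have "cos (2 * pi * real j * 1 - real k * pi / 2) = cos (- (real k * pi / 2) + 2 * real j * pi)"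
    by (simp add: algebra_simps)
  also have "\<dots> = cos (- (real k * pi / 2))"
    unfolding cos_add by (simp only: cos_2npi sin_2npi mult_1_right mult_zero_right diff_zero)
  finally show ?thesis
    by (simp add: fourier_term_def)
qed

lemma dirichlet_kernel:
  "sin (pi * x) * (1 + 2 * (\<Sum>j<M. cos (2 * pi * real (Suc j) * x))) = sin ((2 * real M + 1) * pi * x)"
proof (induction M)
  case (Suc M)
  let ?b = "2 * pi * real (Suc M) * x"
  have "sin (?b + pi * x) - sin (?b - pi * x) = 2 * (sin (pi * x) * cos ?b)"
    by (simp add: sin_add sin_diff)
  moreover have "?b + pi * x = (2 * real (Suc M) + 1) * pi * x" "?b - pi * x = (2 * real M + 1) * pi * x"
    by (simp_all add: algebra_simps)
  ultimately show ?case
    using Suc by (simp add: distrib_left)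
qed simp

text \<open>On a compact part of \<open>(0, 1)\<close> the error is shown to be \<open>O(1 / M)\<close>. The derivative of the partial
  sum is the Dirichlet kernel minus 1, and \<open>sin ((2 M + 1) \<pi> x) / sin (\<pi> x)\<close> is the derivative of
  \<open>- cos ((2 M + 1) \<pi> x) / ((2 M + 1) \<pi> sin (\<pi> x))\<close> up to a function of size \<open>O(1 / M)\<close>. With this
  correction the error has a derivative of size \<open>O(1 / M)\<close>, and the corrected error vanishes at
  \<open>1 / 2\<close>.\<close>
lemma sawtooth_uniform_limit:
  assumes "0 < \<delta>" "\<delta> < 1 / 2"
  shows "uniform_limit {\<delta>..1 - \<delta>} (\<lambda>M x. \<Sum>j<M. fourier_term 1 (Suc j) x) (\<lambda>x. 1 / 2 - x) sequentially"
proof -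
  let ?I = "{\<delta>..1 - \<delta>}"
  have sin_pos: "sin (pi * x) > 0" if "x \<in> ?I" for x
  proof (rule sin_gt_zero)
    show "0 < pi * x"
      using that assms by simp
    show "pi * x < pi"
      using that assms by simp
  qed
  have "\<exists>y\<in>?I. \<forall>x\<in>?I. sin (pi * y) \<le> sin (pi * x)"
    by (intro continuous_attains_inf continuous_intros) (use assms in auto)
  then obtain y where y: "y \<in> ?I" "\<And>x. x \<in> ?I \<Longrightarrow> sin (pi * y) \<le> sin (pi * x)"
    by blast
  \<comment> \<open>A positive lower bound of \<open>sin (\<pi> x)\<close> on the whole interval.\<close>
  define s where "s = sin (pi * y)"
  have s: "s > 0" "s \<le> 1" "\<And>x. x \<in> ?I \<Longrightarrow> s \<le> sin (pi * x)"
    using sin_pos [OF y(1)] y(2) by (auto simp: s_def)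
  have error: "\<bar>(\<Sum>j<M. fourier_term 1 (Suc j) x) - (1 / 2 - x)\<bar> \<le> 2 / s ^ 2 / (2 * real M + 1)"
    if x: "x \<in> ?I" for M x
  proof -
    let ?m = "2 * real M + 1"
    define h where "h x = cos (?m * pi * x) / (?m * pi * sin (pi * x))" for x
    define g where "g x = (\<Sum>j<M. fourier_term 1 (Suc j) x) - (1 / 2 - x) + h x" for x
    have g': "(g has_real_derivative - (cos (?m * pi * x) * cos (pi * x)) / (?m * sin (pi * x) ^ 2))
        (at x within ?I)" if x: "x \<in> ?I" for x
    proof -
      have nz: "sin (pi * x) \<noteq> 0" "?m \<noteq> 0"
        using sin_pos [OF x] by auto
      have "(h has_real_derivative (- sin (?m * pi * x) * (?m * pi) * (?m * pi * sin (pi * x)) -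
          cos (?m * pi * x) * (?m * pi * (cos (pi * x) * pi))) / (?m * pi * sin (pi * x)) ^ 2)
          (at x within ?I)"
        unfolding h_def [abs_def] using nz
        by (auto intro!: derivative_eq_intros simp: power2_eq_square)
      also have "(- sin (?m * pi * x) * (?m * pi) * (?m * pi * sin (pi * x)) -
          cos (?m * pi * x) * (?m * pi * (cos (pi * x) * pi))) / (?m * pi * sin (pi * x)) ^ 2 =
          - (sin (?m * pi * x) / sin (pi * x)) -
          cos (?m * pi * x) * cos (pi * x) / (?m * sin (pi * x) ^ 2)" (is "?L = ?R")
      proof -
        have "(- S * (m * p) * (m * p * t) - C * (m * p * (c * p))) / (m * p * t) ^ 2 =
            - (S / t) - C * c / (m * t ^ 2)"
          if "m \<noteq> 0" "p \<noteq> 0" "t \<noteq> 0" for S C c m p t :: real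
          using that by (simp add: field_simps power2_eq_square)
        from this [OF nz(2) pi_neq_zero nz(1)] show ?thesis .
      qed
      finally have h': "(h has_real_derivative ?R) (at x within ?I)" .
      have "(g has_real_derivative (\<Sum>j<M. fourier_term 0 (Suc j) x) - (0 - 1) + ?R) (at x within ?I)"
        unfolding g_def [abs_def] One_nat_def
        by (intro DERIV_add DERIV_diff DERIV_sum fourier_term_has_derivative DERIV_const DERIV_ident h') auto
      also have "(\<Sum>j<M. fourier_term 0 (Suc j) x) - (0 - 1) = sin (?m * pi * x) / sin (pi * x)"
        using dirichlet_kernel [of x M] nz(1)
        by (simp add: fourier_term_def sum_distrib_left field_simps del: of_nat_Suc)
      finally show ?thesis
        by simp
    qed
    have "norm (g x - g (1 / 2)) \<le> 1 / (?m * s ^ 2) * norm (x - 1 / 2)"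
    proof (rule field_differentiable_bound [OF _ g'])
      fix z assume z: "z \<in> ?I"
      have "norm (- (cos (?m * pi * z) * cos (pi * z)) / (?m * sin (pi * z) ^ 2)) =
          \<bar>cos (?m * pi * z)\<bar> * \<bar>cos (pi * z)\<bar> / (?m * sin (pi * z) ^ 2)"
        by (simp add: abs_mult)
      also have "\<dots> \<le> 1 / (?m * s ^ 2)"
        using s(1) s(3) [OF z]
        by (intro frac_le mult_le_one mult_left_mono power_mono) auto
      finally show "norm (- (cos (?m * pi * z) * cos (pi * z)) / (?m * sin (pi * z) ^ 2)) \<le> 1 / (?m * s ^ 2)" .
    qed (use assms x in auto)
    also have "\<dots> \<le> 1 / (?m * s ^ 2) * 1"
      using x assms by (intro mult_left_mono) (auto simp: abs_if)
    finally have "\<bar>g x - g (1 / 2)\<bar> \<le> 1 / (?m * s ^ 2)"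
      by simp
    moreover have "g (1 / 2) = 0"
    proof -
      have "sin (2 * pi * real (Suc j) * (1 / 2)) = 0" for j
        using sin_npi [of "Suc j"] by (simp add: mult.commute del: of_nat_Suc)
      moreover have "cos (?m * pi * (1 / 2)) = 0"
        by (simp add: distrib_right distrib_left add_divide_distrib cos_add mult.commute)
      ultimately show ?thesis
        unfolding g_def h_def fourier_term_1 by simp
    qed
    moreover have "\<bar>h x\<bar> \<le> 1 / (?m * s ^ 2)"
    proof -
      have "\<bar>h x\<bar> = \<bar>cos (?m * pi * x)\<bar> / (?m * (pi * sin (pi * x)))"
        using sin_pos [OF x] by (simp add: h_def abs_mult)
      also have "\<dots> \<le> 1 / (?m * s ^ 2)"
      proof (intro frac_le mult_left_mono)
        have "s ^ 2 \<le> 1 * s"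
          using s by (simp add: power2_eq_square)
        also have "\<dots> \<le> pi * sin (pi * x)"
          using s(1) s(3) [OF x] pi_ge_two by (intro mult_mono) auto
        finally show "s ^ 2 \<le> pi * sin (pi * x)" .
      qed (use s in auto)
      finally show ?thesis .
    qed
    ultimately have "\<bar>(\<Sum>j<M. fourier_term 1 (Suc j) x) - (1 / 2 - x)\<bar> \<le> 2 * (1 / (?m * s ^ 2))"
      unfolding g_def by linarith
    also have "\<dots> = 2 / s ^ 2 / ?m"
      by simp
    finally show ?thesis .
  qed
  have "(\<lambda>M. 2 / s ^ 2 / (2 * real M + 1)) \<longlonglongrightarrow> 0"
    by real_asymp
  then show ?thesis
    unfolding uniform_limit_iff
  proof safe
    fix e :: real assume "e > 0"
    with \<open>(\<lambda>M. 2 / s ^ 2 / (2 * real M + 1)) \<longlonglongrightarrow> 0\<close>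
    have "\<forall>\<^sub>F M in sequentially. 2 / s ^ 2 / (2 * real M + 1) < e"
      by (rule order_tendstoD)
    then show "\<forall>\<^sub>F M in sequentially. \<forall>x\<in>?I.
        dist (\<Sum>j<M. fourier_term 1 (Suc j) x) (1 / 2 - x) < e"
      by eventually_elim (auto simp only: dist_norm real_norm_def intro: le_less_trans [OF error])
  qed
qed

lemma fourier_series_has_derivative_sawtooth:
  assumes "0 < x" "x < 1"
  shows "((\<lambda>x. \<Sum>j. fourier_term 2 (Suc j) x) has_real_derivative - bernoulli_poly 1 x) (at x)"
proof -
  define \<delta> where "\<delta> = min x (1 - x) / 2"
  have \<delta>: "0 < \<delta>" "\<delta> < 1 / 2" "\<delta> < x" "x < 1 - \<delta>"
    using assms by (auto simp: \<delta>_def min_def field_simps)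
  note lim = sawtooth_uniform_limit [OF \<delta>(1,2)]
  have "((\<lambda>x. \<Sum>j. fourier_term 2 (Suc j) x) has_real_derivative (\<Sum>j. fourier_term 1 (Suc j) x)) (at x)"
  proof (rule has_field_derivative_series')
    show "(fourier_term 2 (Suc j) has_real_derivative fourier_term 1 (Suc j) y) (at y within {\<delta>..1 - \<delta>})"
      for j y using fourier_term_has_derivative [of "Suc j" 1] by (simp add: numeral_2_eq_2)
    show "uniformly_convergent_on {\<delta>..1 - \<delta>} (\<lambda>M y. \<Sum>j<M. fourier_term 1 (Suc j) y)"
      using lim by (auto simp: uniformly_convergent_on_def)
    show "summable (\<lambda>j. fourier_term 2 (Suc j) x)"
      by (rule fourier_series_summable) simp
  qed (use \<delta> in auto)
  moreover have "(\<lambda>j. fourier_term 1 (Suc j) x) sums (1 / 2 - x)"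
    unfolding sums_def by (rule tendsto_uniform_limitI [OF lim]) (use \<delta> in auto)
  ultimately show ?thesis
    by (simp add: sums_iff bernoulli_poly_1 [simplified])
qed

lemma fourier_series_has_derivative:
  assumes "k \<ge> 2"
  shows "((\<lambda>x. \<Sum>j. fourier_term (Suc k) (Suc j) x) has_real_derivative
    (\<Sum>j. fourier_term k (Suc j) x)) (at x)"
proof (rule has_field_derivative_series' [where S = UNIV])
  show "(fourier_term (Suc k) (Suc j) has_real_derivative fourier_term k (Suc j) y) (at y within UNIV)"
    for j y by (rule fourier_term_has_derivative) simp
  show "uniformly_convergent_on UNIV (\<lambda>M y. \<Sum>j<M. fourier_term k (Suc j) y)"
    using fourier_series_uniform_limit [OF assms] by (auto simp: uniformly_convergent_on_def)
  show "summable (\<lambda>j. fourier_term (Suc k) (Suc j) x)"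
    by (rule fourier_series_summable) (use assms in simp)
qed auto

text \<open>Integration determines the next series up to a constant. An undetermined constant \<open>c\<close> in the
  derivative would contribute \<open>c * x\<close>, which is impossible since both the series and the Bernoulli
  polynomial take equal values at 0 and 1.\<close>
lemma fourier_series_integrate:
  assumes "k \<ge> 1"
    and deriv: "\<And>x. 0 < x \<Longrightarrow> x < 1 \<Longrightarrow>
      ((\<lambda>x. \<Sum>j. fourier_term (Suc k) (Suc j) x) has_real_derivative c - bernoulli_poly k x) (at x)"
  shows "\<exists>d. \<forall>x\<in>{0..1}. (\<Sum>j. fourier_term (Suc k) (Suc j) x) = d - bernoulli_poly (Suc k) x"
proof -
  define F where "F x = (\<Sum>j. fourier_term (Suc k) (Suc j) x)" for x
  define G where "G x = F x + bernoulli_poly (Suc k) x - c * x" for x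
  have "continuous_on {0..1} F"
    unfolding F_def [abs_def]
  proof (rule uniform_limit_theorem [OF _ fourier_series_uniform_limit])
    show "\<forall>\<^sub>F N in sequentially. continuous_on {0..1} (\<lambda>x. \<Sum>j<N. fourier_term (Suc k) (Suc j) x)"
      by (intro always_eventually allI continuous_on_sum)
         (auto simp: fourier_term_def intro!: continuous_intros)
  qed (use assms in auto)
  moreover have "continuous_on {0..1} (bernoulli_poly (Suc k))"
    using bernoulli_poly_has_derivative DERIV_continuous_on by blast
  ultimately have cont: "continuous_on {0..1} G"
    unfolding G_def [abs_def] by (intro continuous_intros)
  have "(G has_real_derivative 0) (at x)" if "0 < x" "x < 1" for x
  proof -
    have "(G has_real_derivative (c - bernoulli_poly k x) + bernoulli_poly k x - c * 1) (at x)"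
      unfolding G_def [abs_def] F_def [abs_def]
      by (intro DERIV_add DERIV_diff DERIV_cmult DERIV_ident deriv bernoulli_poly_has_derivative that)
    then show ?thesis
      by simp
  qed
  then have const: "G x = G 0" if "x \<in> {0..1}" for x
    using DERIV_isconst2 [of 0 1 G x] cont that by auto
  have "F 1 = F 0"
    by (simp add: F_def fourier_term_period)
  then have "c = 0"
    using const [of 1] bernoulli_poly_endpoints [of "Suc k"] assms(1) by (simp add: G_def)
  then have "F x = G 0 - bernoulli_poly (Suc k) x" if "x \<in> {0..1}" for x
    using const [OF that] by (simp add: G_def)
  then show ?thesis
    unfolding F_def by blast
qed

text \<open>The induction integrates term by term, starting from the sawtooth function. The constant \<open>d\<close> will
  cancel in sums against functions of mean zero.\<close>
theorem bernoulli_poly_fourier_series: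
  assumes "k \<ge> 2"
  shows "\<exists>d. \<forall>x\<in>{0..1}. (\<lambda>j. fourier_term k (Suc j) x) sums (d - bernoulli_poly k x)"
proof -
  have "\<exists>d. \<forall>x\<in>{0..1}. (\<Sum>j. fourier_term k (Suc j) x) = d - bernoulli_poly k x"
    using assms
  proof (induction k rule: dec_induct)
    case base
    show ?case
      using fourier_series_integrate [of 1 0] fourier_series_has_derivative_sawtooth
      by (simp add: numeral_2_eq_2)
  next
    case (step k)
    then obtain c where c: "\<And>x. x \<in> {0..1} \<Longrightarrow> (\<Sum>j. fourier_term k (Suc j) x) = c - bernoulli_poly k x"
      by blast
    show ?case
    proof (rule fourier_series_integrate)
      show "((\<lambda>x. \<Sum>j. fourier_term (Suc k) (Suc j) x) has_real_derivative c - bernoulli_poly k x) (at x)"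
        if "0 < x" "x < 1" for x
        using fourier_series_has_derivative [OF step.hyps(1), of x] c [of x] that by simp
    qed (use step.hyps in simp)
  qed
  then show ?thesis
    using fourier_series_summable [OF assms] by (metis summable_sums)
qed

section \<open>The finite Fourier transform of \<open>b\<^sub>\<alpha>\<close>\<close>

lemma e_fun_0 [simp]: "e_fun 0 = 1"
  by (simp add: e_fun_def)

lemma e_fun_add: "e_fun (x + y) = e_fun x * e_fun y"
  by (simp add: e_fun_def distrib_left exp_add)

lemma e_fun_of_int_mult: "e_fun (of_int n * x) = e_fun x powi n"
  by (simp add: e_fun_def exp_power_int mult_ac)

lemma e_fun_of_real: "e_fun (of_real x) = cis (2 * pi * x)"
  by (simp add: e_fun_def cis_conv_exp mult_ac)

lemma norm_e_fun_of_real: "norm (e_fun (of_real x)) = 1"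
  by (simp add: e_fun_of_real)

lemma e_fun_frac: "e_fun (of_int a / of_nat h) = e_fun (of_real (of_int a / of_nat h))"
  by simp

lemma norm_e_fun_frac: "norm (e_fun (of_int a / of_nat h)) = 1"
  by (subst e_fun_frac) (rule norm_e_fun_of_real)

lemma e_fun_half_odd:
  assumes "odd a"
  shows "e_fun (of_int a / 2) = - 1"
proof -
  obtain q where "a = 2 * q + 1"
    using assms by (elim oddE)
  then have "e_fun (of_int a / 2) = e_fun (1 / 2 + of_int q)"
    by (simp add: add_divide_distrib add.commute)
  also have "\<dots> = e_fun (1 / 2)"
    by (rule e_fun_add_of_int)
  also have "\<dots> = - 1"
    by (simp add: e_fun_def)
  finally show ?thesis .
qed

lemma sum_roots_of_unity:
  assumes "N > 0"
  shows "(\<Sum>j<N. e_fun (of_int (int j * d) / of_nat N)) = (if int N dvd d then of_nat N else 0)"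
proof -
  define w where "w = e_fun (of_int d / of_nat N)"
  have power: "e_fun (of_int (int j * d) / of_nat N) = w ^ j" for j
    using e_fun_of_int_mult [of "int j" "of_int d / of_nat N"] by (simp add: w_def)
  have "w ^ N = 1"
    using power [of N] assms e_fun_add_of_int [of 0 d] by simp
  show ?thesis
  proof (cases "int N dvd d")
    case True
    then obtain q where "d = int N * q"
      by blast
    then have "w = 1"
      using assms e_fun_add_of_int [of 0 q] by (simp add: w_def)
    with True show ?thesis
      by (simp only: power) simp
  next
    case False
    have "w \<noteq> 1"
    proof
      assume "w = 1"
      then obtain q where "2 * pi * (of_int d / of_nat N) = of_int (2 * q) * pi"
        using assms by (auto simp: w_def e_fun_def exp_eq_1)
      then have "real_of_int d = real_of_int (q * int N)"
        using assms by (simp add: field_simps)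
      then have "d = q * int N"
        by (simp only: of_int_eq_iff)
      with False show False
        by simp
    qed
    with False \<open>w ^ N = 1\<close> show ?thesis
      by (simp only: power sum_gp_strict) simp
  qed
qed

lemma sum_shift_periodic:
  fixes f :: "int \<Rightarrow> 'a :: comm_monoid_add"
  assumes "\<And>k. f (k + int N) = f k"
  shows "(\<Sum>k<N. f (int k + int c)) = (\<Sum>k<N. f (int k))"
proof (induction c)
  case (Suc c)
  show ?case
  proof (cases N)
    case (Suc M)
    have "(\<Sum>k<N. f (int k + int (Suc c))) = (\<Sum>k<M. f (int (Suc k) + int c)) + f (int c + int N)"
      using Suc by (simp add: add_ac)
    also have "f (int c + int N) = f (int c)"
      by (rule assms)
    also have "(\<Sum>k<M. f (int (Suc k) + int c)) + f (int c) = (\<Sum>k<N. f (int k + int c))"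
      unfolding Suc sum.lessThan_Suc_shift by (simp add: add.commute)
    finally show ?thesis
      using Suc.IH by simp
  qed simp
qed simp

definition gauss_sum :: "nat \<Rightarrow> int \<Rightarrow> int \<Rightarrow> complex" where
  "gauss_sum h u j = (\<Sum>k<2 * h. e_fun (of_int (u * int k ^ 2 + (u + j) * int k) / of_nat (2 * h)))"

definition b_dft :: "nat \<Rightarrow> int \<Rightarrow> int \<Rightarrow> complex" where
  "b_dft h u j = (\<Sum>r=1..4 * h. b_fun h u (int r) * e_fun (of_int (j * int r) / of_nat (4 * h)))"

text \<open>Only odd \<open>r = 2 k + 1\<close> contribute, and then the phases of \<open>b\<^sub>\<alpha>(r)\<close> and of the character
  add up to a quadratic polynomial in \<open>k\<close> with denominator \<open>2 h\<close>.\<close>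
lemma b_dft_eq_gauss_sum:
  assumes "h > 0"
  shows "b_dft h u j = e_fun (of_int j / of_nat (4 * h)) * gauss_sum h u j"
proof -
  let ?f = "\<lambda>r. b_fun h u (int r) * e_fun (of_int (j * int r) / of_nat (4 * h))"
  have "b_dft h u j = (\<Sum>r\<in>(\<lambda>k. 2 * k + 1) ` {..<2 * h}. ?f r)"
    unfolding b_dft_def
  proof (rule sum.mono_neutral_right)
    show "\<forall>r\<in>{1..4 * h} - (\<lambda>k. 2 * k + 1) ` {..<2 * h}. ?f r = 0"
    proof
      fix r assume r: "r \<in> {1..4 * h} - (\<lambda>k. 2 * k + 1) ` {..<2 * h}"
      have "even r"
      proof (rule ccontr)
        assume "odd r"
        then obtain k where "r = 2 * k + 1"
          by (elim oddE)
        with r show False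
          by auto
      qed
      then show "?f r = 0"
        by (simp add: b_fun_def)
    qed
  qed auto
  also have "\<dots> = (\<Sum>k<2 * h. ?f (2 * k + 1))"
    by (subst sum.reindex) (auto simp: inj_on_def)
  also have "\<dots> = (\<Sum>k<2 * h. e_fun (of_int j / of_nat (4 * h)) *
      e_fun (of_int (u * int k ^ 2 + (u + j) * int k) / of_nat (2 * h)))"
  proof (intro sum.cong refl)
    fix k
    have "2 * triangular (int k) = int k * (int k + 1)"
      by (simp add: triangular_def)
    then have T: "2 * (of_int (triangular (int k)) :: complex) = of_nat k * (of_nat k + 1)"
      by (metis of_int_mult of_int_numeral of_int_add of_int_1 of_int_of_nat_eq)
    have "?f (2 * k + 1) = e_fun (of_int (u * triangular (int k)) / of_nat h +
        of_int (j * (2 * int k + 1)) / of_nat (4 * h))"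
    proof -
      have "int (2 * k + 1) = 2 * int k + 1"
        by simp
      then show ?thesis
        by (simp only: b_fun_odd e_fun_add)
    qed
    also have "of_int (u * triangular (int k)) / of_nat h + of_int (j * (2 * int k + 1)) / of_nat (4 * h) =
        (of_int j / of_nat (4 * h) + of_int (u * int k ^ 2 + (u + j) * int k) / of_nat (2 * h) :: complex)"
      (is "?L = ?R")
    proof -
      have "?L = (2 * of_int u * (2 * of_int (triangular (int k))) + of_int j * (2 * of_nat k + 1))
          / of_nat (4 * h)"
        using assms by (simp add: field_simps)
      also have "\<dots> = ?R"
        unfolding T using assms by (simp add: field_simps power2_eq_square)
      finally show ?thesis .
    qed
    finally show "?f (2 * k + 1) = e_fun (of_int j / of_nat (4 * h)) *
        e_fun (of_int (u * int k ^ 2 + (u + j) * int k) / of_nat (2 * h))"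
      by (simp only: e_fun_add)
  qed
  finally show ?thesis
    by (simp add: gauss_sum_def sum_distrib_left)
qed

lemma norm_b_dft:
  assumes "h > 0"
  shows "norm (b_dft h u j) = norm (gauss_sum h u j)"
  using assms by (simp only: b_dft_eq_gauss_sum norm_mult norm_e_fun_frac mult_1_left)

lemma gauss_sum_cong:
  assumes "h > 0" "[j = j'] (mod (2 * int h))"
  shows "gauss_sum h u j = gauss_sum h u j'"
  unfolding gauss_sum_def
  by (intro sum.cong refl e_fun_div_cong cong_add cong_mult cong_refl) (use assms in simp_all)

text \<open>Substituting \<open>k + c\<close> for \<open>k\<close> permutes the residues modulo \<open>2 h\<close> and, besides adding a constant, only
  changes the linear coefficient of the exponent, by \<open>2 u c\<close>.\<close>
lemma gauss_sum_shift:
  assumes "h > 0"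
  shows "gauss_sum h u j =
    e_fun (of_int (u * int c ^ 2 + (u + j) * int c) / of_nat (2 * h)) * gauss_sum h u (j + 2 * u * int c)"
proof -
  define f where "f k = e_fun (of_int (u * k ^ 2 + (u + j) * k) / of_nat (2 * h))" for k
  have period: "f (k + int (2 * h)) = f k" for k
    unfolding f_def
  proof (rule e_fun_div_cong)
    have "[k + int (2 * h) = k] (mod int (2 * h))"
      by (simp add: cong_def)
    then show "[u * (k + int (2 * h)) ^ 2 + (u + j) * (k + int (2 * h)) = u * k ^ 2 + (u + j) * k]
        (mod int (2 * h))"
      by (intro cong_add cong_mult cong_pow cong_refl)
  qed (use assms in simp)
  have "gauss_sum h u j = (\<Sum>k<2 * h. f (int k + int c))"
    unfolding sum_shift_periodic [of f, OF period] by (simp add: gauss_sum_def f_def)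
  also have "\<dots> = (\<Sum>k<2 * h. e_fun (of_int (u * int c ^ 2 + (u + j) * int c) / of_nat (2 * h)) *
      e_fun (of_int (u * int k ^ 2 + (u + (j + 2 * u * int c)) * int k) / of_nat (2 * h)))"
  proof (intro sum.cong refl)
    fix k
    have "u * (int k + int c) ^ 2 + (u + j) * (int k + int c) =
        (u * int c ^ 2 + (u + j) * int c) + (u * int k ^ 2 + (u + (j + 2 * u * int c)) * int k)"
      by (simp add: algebra_simps power2_eq_square)
    then show "f (int k + int c) = e_fun (of_int (u * int c ^ 2 + (u + j) * int c) / of_nat (2 * h)) *
        e_fun (of_int (u * int k ^ 2 + (u + (j + 2 * u * int c)) * int k) / of_nat (2 * h))"
      unfolding f_def by (simp only: of_int_add add_divide_distrib e_fun_add)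
  qed
  finally show ?thesis
    by (simp add: gauss_sum_def sum_distrib_left)
qed

text \<open>For even \<open>j\<close> the shift by \<open>h\<close> reproduces the sum with the factor \<open>-1\<close>.\<close>
lemma gauss_sum_even:
  assumes "h > 0" "even h" "odd u" "even j"
  shows "gauss_sum h u j = 0"
proof -
  have "of_int (u * int h ^ 2 + (u + j) * int h) / of_nat (2 * h) =
      (of_int (u * int h + u + j) / 2 :: complex)"
    using assms(1) by (simp add: field_simps power2_eq_square)
  moreover have "e_fun (of_int (u * int h + u + j) / 2) = - 1"
    by (rule e_fun_half_odd) (use assms in simp)
  moreover have "gauss_sum h u (j + 2 * u * int h) = gauss_sum h u j"
    by (rule gauss_sum_cong [OF assms(1)]) (simp add: cong_iff_dvd_diff)
  ultimately have "gauss_sum h u j = - 1 * gauss_sum h u j"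
    using gauss_sum_shift [OF assms(1), of u j h] by (simp only:)
  then show ?thesis
    by simp
qed

text \<open>Since \<open>u\<close> is invertible, every odd class modulo \<open>2 h\<close> is of the form \<open>1 + 2 u c\<close>.\<close>
lemma norm_gauss_sum_odd:
  assumes "h > 0" "coprime u (int h)" "odd j"
  shows "norm (gauss_sum h u j) = norm (gauss_sum h u 1)"
proof -
  obtain q where q: "j = 2 * q + 1"
    using assms(3) by (elim oddE)
  obtain v where v: "[u * v = 1] (mod int h)"
    using cong_solve_coprime_int [OF assms(2)] by blast
  define c where "c = nat ((v * q) mod int h)"
  have "int c = (v * q) mod int h"
    using assms(1) by (simp add: c_def)
  then have "[int c = v * q] (mod int h)"
    by (simp add: cong_def)
  then have "[u * int c = u * (v * q)] (mod int h)"
    by (rule cong_scalar_left)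
  also have "[u * (v * q) = q] (mod int h)"
    using cong_scalar_right [OF v, of q] by (simp add: mult.assoc)
  finally have "[2 * (u * int c) = 2 * q] (mod (2 * int h))"
    by (simp add: cong_def)
  from cong_add [OF this cong_refl [of 1]] have "[1 + 2 * u * int c = j] (mod (2 * int h))"
    unfolding q by (simp only: mult.assoc add.commute)
  then have "gauss_sum h u j = gauss_sum h u (1 + 2 * u * int c)"
    using gauss_sum_cong [OF assms(1)] by metis
  then show ?thesis
    using gauss_sum_shift [OF assms(1), of u 1 c] by (simp only: norm_mult norm_e_fun_frac mult_1_left)
qed

text \<open>If \<open>gauss_sum h u 1\<close> were 0, the whole transform would vanish, but Fourier inversion recovers
  \<open>b\<^sub>\<alpha>(1) = 1\<close> from it.\<close>
lemma gauss_sum_1_nonzero: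
  assumes "h > 0" "even h" "odd u" "coprime u (int h)"
  shows "gauss_sum h u 1 \<noteq> 0"
proof
  assume "gauss_sum h u 1 = 0"
  then have zero: "b_dft h u j = 0" for j
    using gauss_sum_even [OF assms(1-3), of j] norm_gauss_sum_odd [OF assms(1,4), of j]
      b_dft_eq_gauss_sum [OF assms(1), of u j] by (cases "even j") auto
  let ?N = "4 * h"
  have "0 = (\<Sum>j<?N. b_dft h u (int j) * e_fun (of_int (- int j) / of_nat ?N))"
    by (simp add: zero)
  also have "\<dots> = (\<Sum>j<?N. \<Sum>r=1..?N. b_fun h u (int r) *
      e_fun (of_int (int j * (int r - 1)) / of_nat ?N))"
    unfolding b_dft_def sum_distrib_right
  proof (intro sum.cong refl)
    fix j r
    have "of_int (int j * (int r - 1)) / of_nat ?N =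
        (of_int (int j * int r) / of_nat ?N + of_int (- int j) / of_nat ?N :: complex)"
      unfolding add_divide_distrib [symmetric] by (simp add: algebra_simps)
    then show "b_fun h u (int r) * e_fun (of_int (int j * int r) / of_nat ?N) *
          e_fun (of_int (- int j) / of_nat ?N) =
        b_fun h u (int r) * e_fun (of_int (int j * (int r - 1)) / of_nat ?N)"
      by (simp only: e_fun_add mult.assoc)
  qed
  also have "\<dots> = (\<Sum>r=1..?N. b_fun h u (int r) *
      (\<Sum>j<?N. e_fun (of_int (int j * (int r - 1)) / of_nat ?N)))"
    unfolding sum_distrib_left by (rule sum.swap)
  also have "\<dots> = (\<Sum>r=1..?N. if r = 1 then of_nat ?N else 0)"
  proof (intro sum.cong refl)
    fix r assume r: "r \<in> {1..?N}"
    have "int ?N dvd int r - 1 \<longleftrightarrow> r = 1"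
      using r zdvd_not_zless [of "int r - 1" "int ?N"] by (cases "r = 1") auto
    then have "(\<Sum>j<?N. e_fun (of_int (int j * (int r - 1)) / of_nat ?N)) =
        (if r = 1 then of_nat ?N else 0)"
      using assms(1) by (subst sum_roots_of_unity) auto
    moreover have "b_fun h u 1 = 1"
      by (simp add: b_fun_def triangular_def)
    ultimately show "b_fun h u (int r) *
        (\<Sum>j<?N. e_fun (of_int (int j * (int r - 1)) / of_nat ?N)) = (if r = 1 then of_nat ?N else 0)"
      by simp
  qed
  also have "\<dots> = of_nat ?N"
    using assms(1) by simp
  finally show False
    using assms(1) by simp
qed

lemma b_fun_minus: "b_fun h u (- m) = b_fun h u m"
proof (cases "odd m")
  case True
  then obtain k where m: "m = 2 * k + 1"
    by (elim oddE)
  then have "- m = 2 * (- k - 1) + 1"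
    by simp
  moreover have "triangular (- k - 1) = triangular k"
    by (simp add: triangular_def algebra_simps)
  ultimately show ?thesis
    unfolding m by (metis b_fun_odd)
qed (simp add: b_fun_def)

lemma b_dft_minus:
  assumes "h > 0"
  shows "b_dft h u (- j) = b_dft h u j"
proof -
  let ?f = "\<lambda>j r. b_fun h u (int r) * e_fun (of_int (j * int r) / of_nat (4 * h))"
  have drop_last: "b_dft h u j = (\<Sum>r=1..4 * h - 1. ?f j r)" for j
    unfolding b_dft_def
  proof (rule sum.mono_neutral_right)
    show "\<forall>r\<in>{1..4 * h} - {1..4 * h - 1}. ?f j r = 0"
    proof
      fix r assume "r \<in> {1..4 * h} - {1..4 * h - 1}"
      then have "r = 4 * h"
        by auto
      then show "?f j r = 0"
        by (simp add: b_fun_def)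
    qed
  qed auto
  have "(\<Sum>r=1..4 * h - 1. ?f (- j) r) = (\<Sum>r=1..4 * h - 1. ?f j r)"
  proof (rule sum.reindex_bij_witness [of _ "\<lambda>r. 4 * h - r" "\<lambda>r. 4 * h - r"])
    fix r assume r: "r \<in> {1..4 * h - 1}"
    have diff: "int (4 * h - r) = - int r + 4 * int h"
      using r by auto
    have "b_fun h u (int (4 * h - r)) = b_fun h u (int r)"
      by (simp only: diff b_fun_periodic [OF assms] b_fun_minus)
    moreover have "e_fun (of_int (j * int (4 * h - r)) / of_nat (4 * h)) =
        e_fun (of_int (- j * int r) / of_nat (4 * h))"
      unfolding diff
      by (rule e_fun_div_cong) (use assms in \<open>auto simp: cong_iff_dvd_diff algebra_simps\<close>)
    ultimately show "?f j (4 * h - r) = ?f (- j) r"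
      by simp
  qed auto
  then show ?thesis
    by (simp only: drop_last)
qed

text \<open>The Fourier series of Bernoulli polynomials of even index consists of cosines. Since \<open>b\<^sub>\<alpha>\<close> is an
  even function, summing it against a cosine gives its transform.\<close>
lemma b_dft_eq_cos_sum:
  assumes "h > 0"
  shows "(\<Sum>r=1..4 * h. b_fun h u (int r) * of_real (cos (2 * pi * real j * (real r / real (4 * h)))))
    = b_dft h u (int j)"
proof -
  have "e_fun (of_int (int j * int r) / of_nat (4 * h)) + e_fun (of_int (- int j * int r) / of_nat (4 * h))
      = 2 * of_real (cos (2 * pi * real j * (real r / real (4 * h))))" for r
  proof -
    let ?x = "real j * (real r / real (4 * h))"
    have "of_int (int j * int r) / of_nat (4 * h) = (of_real ?x :: complex)"
      "of_int (- int j * int r) / of_nat (4 * h) = (of_real (- ?x) :: complex)"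
      by simp_all
    then have "e_fun (of_int (int j * int r) / of_nat (4 * h)) +
        e_fun (of_int (- int j * int r) / of_nat (4 * h)) = cis (2 * pi * ?x) + cis (2 * pi * - ?x)"
      by (simp only: e_fun_of_real)
    also have "\<dots> = 2 * of_real (cos (2 * pi * ?x))"
      by (simp add: complex_eq_iff)
    finally show ?thesis
      by (simp only: mult.assoc)
  qed
  then have "b_dft h u (int j) + b_dft h u (- int j) = 2 * (\<Sum>r=1..4 * h. b_fun h u (int r) *
      of_real (cos (2 * pi * real j * (real r / real (4 * h)))))"
    unfolding b_dft_def sum.distrib [symmetric] distrib_left [symmetric] sum_distrib_left
    by (intro sum.cong) (simp_all only: mult.left_commute)
  then show ?thesis
    by (simp add: b_dft_minus [OF assms])
qed

section \<open>Non-vanishing\<close>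

text \<open>The first term exceeds all others together, because \<open>\<Sum>n\<ge>2. 1 / n\<^sup>2 < 1\<close>. That follows by comparison
  with the telescoping series of \<open>1 / (n\<^sup>2 - 1 / 4) = 1 / (n - 1 / 2) - 1 / (n + 1 / 2)\<close>.\<close>
lemma dirichlet_series_nonzero:
  fixes a :: "nat \<Rightarrow> complex"
  assumes sums: "(\<lambda>j. a (Suc j) / of_nat (Suc j) ^ k) sums s"
    and bound: "\<And>j. norm (a (Suc j)) \<le> norm (a 1)" and "a 1 \<noteq> 0" and "k \<ge> 2"
  shows "s \<noteq> 0"
proof
  assume "s = 0"
  define f where "f j = 1 / (real j + 3 / 2)" for j
  have "f \<longlonglongrightarrow> 0"
    unfolding f_def [abs_def] by real_asymp
  then have "(\<lambda>j. f j - f (Suc j)) sums (f 0 - 0)"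
    by (rule telescope_sums')
  then have tele: "(\<lambda>j. norm (a 1) * (f j - f (Suc j))) sums (norm (a 1) * (2 / 3))"
    by (intro sums_mult) (simp add: f_def)
  have le: "norm (a (Suc (Suc j)) / of_nat (Suc (Suc j)) ^ k) \<le> norm (a 1) * (f j - f (Suc j))" for j
  proof -
    let ?m = "real (Suc (Suc j))"
    have "norm (a (Suc (Suc j)) / of_nat (Suc (Suc j)) ^ k) = norm (a (Suc (Suc j))) / ?m ^ k"
      by (simp add: norm_divide norm_power del: of_nat_Suc)
    also have "\<dots> \<le> norm (a 1) / ?m ^ 2"
      by (intro frac_le bound power_increasing) (use \<open>k \<ge> 2\<close> in auto)
    also have "\<dots> = norm (a 1) * (1 / ?m ^ 2)"
      by simp
    also have "1 / ?m ^ 2 \<le> 1 / (?m ^ 2 - 1 / 4)"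
    proof (intro frac_le)
      have "1 \<le> ?m ^ 2"
        by (intro one_le_power) simp
      then show "0 < ?m ^ 2 - 1 / 4"
        by linarith
    qed auto
    also have "\<dots> = f j - f (Suc j)"
    proof -
      have "1 / (m ^ 2 - 1 / 4) = 1 / (m - 1 / 2) - 1 / (m + 1 / 2)" if "m > 1" for m :: real
      proof -
        have "m ^ 2 - 1 / 4 = (m - 1 / 2) * (m + 1 / 2)"
          by (simp add: algebra_simps power2_eq_square)
        then show ?thesis
          using that by (simp add: diff_frac_eq)
      qed
      from this [of ?m] show ?thesis
        by (simp add: f_def add_ac)
    qed
    finally show ?thesis
      by (simp add: mult_left_mono)
  qed
  have "(\<lambda>j. a (Suc (Suc j)) / of_nat (Suc (Suc j)) ^ k) sums (- a 1)"
    using sums \<open>s = 0\<close> sums_Suc_iff [of "\<lambda>j. a (Suc j) / of_nat (Suc j) ^ k" "- a 1"] by simp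
  then have "norm (a 1) = norm (\<Sum>j. a (Suc (Suc j)) / of_nat (Suc (Suc j)) ^ k)"
    by (simp add: sums_iff del: of_nat_Suc)
  also have "\<dots> \<le> (\<Sum>j. norm (a 1) * (f j - f (Suc j)))"
    by (rule norm_suminf_le) (use le tele in \<open>auto simp: sums_iff\<close>)
  also have "\<dots> = norm (a 1) * (2 / 3)"
    using tele by (simp add: sums_iff)
  finally show False
    using \<open>a 1 \<noteq> 0\<close> by simp
qed

text \<open>Inserting the Fourier series of the Bernoulli polynomial into the finite sum turns it into the
  Dirichlet series of the finite Fourier transform of \<open>b\<^sub>\<alpha>\<close>. The constant of the Fourier
  series drops out, because \<open>b\<^sub>\<alpha>\<close> has mean zero.\<close>
lemma b_dft_series:
  assumes "h > 0" "even h" "odd u"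
  shows "(\<lambda>j. b_dft h u (int (Suc j)) / of_nat (Suc j) ^ (2 * n + 2)) sums
    ((- 1) ^ n * of_real ((2 * pi) ^ (2 * n + 2) / 2) *
      (\<Sum>r=1..4 * h. b_fun h u (int r) * of_real (bernoulli_poly (2 * n + 2) (real r / real (4 * h)))))"
proof -
  let ?k = "2 * n + 2" and ?x = "\<lambda>r. real r / real (4 * h)"
  let ?c = "complex_of_real ((2 * pi) ^ ?k / 2)"
  let ?p = "\<lambda>r. complex_of_real (bernoulli_poly ?k (?x r))"
  have "?k \<ge> 2"
    by simp
  from bernoulli_poly_fourier_series [OF this] obtain d
    where "\<forall>x\<in>{0..1}. (\<lambda>j. fourier_term ?k (Suc j) x) sums (d - bernoulli_poly ?k x)" ..
  note d = bspec [OF this]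
  have "(\<lambda>j. \<Sum>r=1..4 * h. b_fun h u (int r) * of_real (fourier_term ?k (Suc j) (?x r))) sums
      (\<Sum>r=1..4 * h. b_fun h u (int r) * of_real (d - bernoulli_poly ?k (?x r)))"
    by (intro sums_sum sums_mult sums_of_real d) (use assms in auto)
  also have "(\<Sum>r=1..4 * h. b_fun h u (int r) * of_real (d - bernoulli_poly ?k (?x r))) =
      b_dft h u 0 * of_real d - (\<Sum>r=1..4 * h. b_fun h u (int r) * ?p r)"
    by (simp add: b_dft_def right_diff_distrib sum_subtractf sum_distrib_right)
  also have "b_dft h u 0 = 0"
    using assms by (simp add: b_dft_eq_gauss_sum gauss_sum_even)
  finally have sums: "(\<lambda>j. \<Sum>r=1..4 * h. b_fun h u (int r) * of_real (fourier_term ?k (Suc j) (?x r))) sums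
      - (\<Sum>r=1..4 * h. b_fun h u (int r) * ?p r)"
    by simp
  have "(- 1) ^ Suc n * ?c * (\<Sum>r=1..4 * h. b_fun h u (int r) * of_real (fourier_term ?k (Suc j) (?x r))) =
      b_dft h u (int (Suc j)) / of_nat (Suc j) ^ ?k" for j
  proof -
    let ?m = "Suc j"
    have "(- 1) ^ Suc n * ((2 * pi) ^ ?k / 2) * fourier_term ?k ?m x =
        cos (2 * pi * real ?m * x) / real ?m ^ ?k" for x
    proof -
      have "real ?k * pi / 2 = real (Suc n) * pi"
        by (simp add: field_simps)
      then have "cos (2 * pi * real ?m * x - real ?k * pi / 2) = (- 1) ^ Suc n * cos (2 * pi * real ?m * x)"
        unfolding cos_diff by (simp only: cos_npi sin_npi) simp
      then have "fourier_term ?k ?m x =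
          2 * ((- 1) ^ Suc n * cos (2 * pi * real ?m * x)) / ((2 * pi) ^ ?k * real ?m ^ ?k)"
        by (simp only: fourier_term_def power_mult_distrib [of "2 * pi"])
      moreover have "e * (P / 2) * (2 * (e * C) / (P * M)) = C / M"
        if "e * e = 1" "P \<noteq> 0" for e P C M :: real
      proof -
        have "e * (P / 2) * (2 * (e * C) / (P * M)) = (e * e) * C / M"
          using that(2) by (simp add: mult_ac)
        then show ?thesis
          using that(1) by simp
      qed
      note this [of "(- 1) ^ Suc n" "(2 * pi) ^ ?k" "cos (2 * pi * real ?m * x)" "real ?m ^ ?k"]
      moreover have "(- 1) ^ Suc n * (- 1) ^ Suc n = (1 :: real)"
        by (simp add: power_mult_distrib [symmetric])
      moreover have "(2 * pi) ^ ?k \<noteq> 0"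
        by simp
      ultimately show ?thesis
        by metis
    qed
    note real_identity = this
    have cosine: "(- 1) ^ Suc n * ?c * of_real (fourier_term ?k ?m x) =
        of_real (cos (2 * pi * real ?m * x)) / of_nat ?m ^ ?k" for x
      using arg_cong [OF real_identity, of complex_of_real x]
      by (simp only: of_real_mult of_real_power of_real_minus of_real_1 of_real_divide of_real_of_nat_eq)
    have "(- 1) ^ Suc n * ?c * (\<Sum>r=1..4 * h. b_fun h u (int r) * of_real (fourier_term ?k ?m (?x r))) =
        (\<Sum>r=1..4 * h. b_fun h u (int r) * ((- 1) ^ Suc n * ?c * of_real (fourier_term ?k ?m (?x r))))"
      by (simp only: sum_distrib_left mult.left_commute)
    also have "\<dots> = (\<Sum>r=1..4 * h. b_fun h u (int r) * of_real (cos (2 * pi * real ?m * ?x r))) / of_nat ?m ^ ?k"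
      by (simp only: cosine sum_divide_distrib times_divide_eq_right)
    also have "\<dots> = b_dft h u (int ?m) / of_nat ?m ^ ?k"
      by (simp only: b_dft_eq_cos_sum [OF assms(1)])
    finally show ?thesis .
  qed
  note coeff = this
  have "(- 1) ^ Suc n * ?c * - S = (- 1) ^ n * ?c * S" for S
    by simp
  with sums_mult [OF sums, of "(- 1) ^ Suc n * ?c"] show ?thesis
    by (simp only: coeff)
qed

text \<open>The transform vanishes at even arguments and has constant non-zero modulus at odd ones, so the
  coefficient of index 1 of its Dirichlet series is one of largest modulus.\<close>
lemma b_bernoulli_sum_nonzero:
  assumes "h > 0" "even h" "odd u" "coprime u (int h)"
  shows "(\<Sum>r=1..4 * h. b_fun h u (int r) * of_real (bernoulli_poly (2 * n + 2) (real r / real (4 * h)))) \<noteq> 0"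
proof -
  have "norm (gauss_sum h u j) \<le> norm (gauss_sum h u 1)" for j
    using gauss_sum_even [OF assms(1-3), of j] norm_gauss_sum_odd [OF assms(1,4), of j]
    by (cases "even j") simp_all
  then have "norm (b_dft h u (int (Suc j))) \<le> norm (b_dft h u (int 1))" for j
    by (simp only: norm_b_dft [OF assms(1)] of_nat_1)
  moreover have "b_dft h u (int 1) \<noteq> 0"
    using gauss_sum_1_nonzero [OF assms] norm_b_dft [OF assms(1), of u 1] by auto
  ultimately show ?thesis
    using dirichlet_series_nonzero [OF b_dft_series [OF assms(1-3), of n]] by auto
qed

lemma coprime_of_Units_residue_ring:
  assumes "m > 1" "\<alpha> \<in> Units (residue_ring m)" "[u = \<alpha>] (mod m)"
  shows "coprime u m"
proof -
  interpret residues m "residue_ring m"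
    by unfold_locales (use assms(1) in simp_all)
  have "coprime \<alpha> m"
    using assms(2) res_units_eq by auto
  then show ?thesis
    using assms(3) by (metis cong_imp_coprime cong_sym)
qed

theorem theorem4p2:
  fixes h n :: nat and \<alpha> u :: int
  assumes "h \<ge> 2" and "even h"
    and "\<alpha> \<in> Units (residue_ring (2 * int h))"
    and "odd u" and "[u = \<alpha>] (mod (2 * int h))"
  shows "L_fun h u (- 2 * of_nat n - 1) \<noteq> 0"
proof -
  let ?m = "2 * n + 1" and ?x = "\<lambda>r. real r / real (4 * h)"
  let ?s = "- 2 * of_nat n - 1 :: complex"
  have h: "h > 0"
    using assms(1) by simp
  have "coprime u (2 * int h)"
    by (rule coprime_of_Units_residue_ring) (use assms in auto)
  then have coprime: "coprime u (int h)"
    by simp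
  have s: "?s = - of_nat ?m" and index: "Suc ?m = 2 * n + 2"
    by simp_all
  have "\<not> Re ?s > 1" "?s \<noteq> 1"
    by (auto simp: complex_eq_iff)
  then have "L_fun h u ?s = hurwitz_sum h u ?s"
    by (simp only: L_fun_def if_False)
  also have "\<dots> = of_nat (4 * h) powr (- ?s) *
      (\<Sum>r=1..4 * h. - fact ?m * (b_fun h u (int r) * of_real (bernoulli_poly (2 * n + 2) (?x r))))"
    unfolding hurwitz_sum_def
  proof (rule arg_cong2 [where f = "(*)", OF refl], rule sum.cong [OF refl])
    fix r assume r: "r \<in> {1..4 * h}"
    have "hurwitz_zeta ?s (?x r) = - of_real (fact ?m * bernoulli_poly (Suc ?m) (?x r))"
      unfolding s by (rule hurwitz_zeta_neg_nat) (use r h in simp)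
    then show "b_fun h u (int r) * hurwitz_zeta ?s (?x r) =
        - fact ?m * (b_fun h u (int r) * of_real (bernoulli_poly (2 * n + 2) (?x r)))"
      using index by (simp only: of_real_mult of_real_fact mult_minus_left mult_minus_right mult.left_commute)
  qed
  also have "\<dots> = of_nat (4 * h) powr (- ?s) * (- fact ?m *
      (\<Sum>r=1..4 * h. b_fun h u (int r) * of_real (bernoulli_poly (2 * n + 2) (?x r))))"
    by (simp only: sum_distrib_left)
  finally have L: "L_fun h u ?s = \<dots>" .
  have "of_nat (4 * h) powr (- ?s) \<noteq> 0"
    using h by simp
  moreover have "- fact ?m \<noteq> (0 :: complex)"
    by (simp only: neg_equal_0_iff_equal fact_nonzero not_False_eq_True)
  ultimately show ?thesis
    unfolding L using b_bernoulli_sum_nonzero [OF h assms(2,4) coprime, of n]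
    by (simp only: mult_eq_0_iff simp_thms)
qed

end
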